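(* Fix an integer $r\ge2$ and let \[ P_r(x;t)=t^r(1-t)^r-x\,\frac{(1-t)^{r+1}-t^{r+1}}{1-2t}, \] a polynomial in $t$. Let $t_1(x),\dots,t_r(x)$ be the ``small'' zeroes of $P_r(x;t)$ in $t$, i.e. those zeroes (Puiseux series in $x$) with $\lim_{x\to0}t(x)=0$. Then \[ \sum_{k\ge1}\mathsf{tr}(k,r)\,x^k=-\frac12\sum_{i=1}^r\frac{t_i(x)^r(1-t_i(x))^r(1-2t_i(x))^2}{\big(\tfrac{d}{dt}P_r\big)(x;t_i(x))}. \]
   Context: For integers $k\ge 3$, $r\ge 1$, let $\mathrm{SC}(k,r)$ be a convex $k$-gon in the plane each of whose sides is subdivided by $r-1$ additional points lying on that side. A triangulation of a finite planar point set is a maximal dissection of its convex hull into triangles by non-crossing segments between points of the set (no point lying in the interior of a triangle side). For $k\ge3$, $\mathsf{tr}(k,r)$ is the number of triangulations of $\mathrm{SC}(k,r)$. For all $k\ge1$ (in particular $k\in\{1,2\}$), $\mathsf{tr}(k,r)$ is taken to be given by $-\frac{1}{4\pi i}\int_{\mathcal C}\frac{((1-t)^{r+1}-t^{r+1})^k\,dt}{t^{rk}(1-t)^{rk}(1-2t)^{k-2}}$ with $\mathcal C$ a small positively oriented contour around $0$ (this agrees with the triangulation count for $k\ge3$). There are exactly $r$ small zeroes, of the form $t(\omega^i x^{1/r})$, $\omega=e^{2\pi i/r}$, for a power series $t(X)$ with $t(0)=0$. *)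

theory Defs
  imports "HOL-Complex_Analysis.Complex_Analysis"
    "HOL-Computational_Algebra.Computational_Algebra"
begin

text \<open>
  For all \<open>k \<ge> 1\<close>, \<open>tr k r\<close> is given by its contour integral representation; for \<open>k \<ge> 3\<close> it is the
  number of triangulations of a convex \<open>k\<close>-gon whose sides are subdivided by \<open>r - 1\<close> points each.
  The only singularity of the integrand in the disc of radius \<open>1/2\<close> is the pole at \<open>0\<close>, so every
  circle around \<open>0\<close> of radius less than \<open>1/2\<close> yields the same value. The exponent \<open>k - 2\<close> is an
  integer, negative for \<open>k = 1\<close>. The values are complex because \<open>tr 1 r\<close> and \<open>tr 2 r\<close> need not be
  natural numbers (for example, \<open>tr 1 2 = 3/2\<close>).
\<close>

definition tr :: "nat \<Rightarrow> nat \<Rightarrow> complex" where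
  "tr k r = - (1 / (4 * of_real pi * \<i>)) *
     contour_integral (circlepath 0 (1/4))
       (\<lambda>t. ((1 - t) ^ (r + 1) - t ^ (r + 1)) ^ k /
            (t ^ (r * k) * (1 - t) ^ (r * k) * (1 - 2 * t) powi (int k - 2)))"

text \<open>
  The polynomial \<open>P\<^sub>r(x; t)\<close> in \<open>t\<close> over a field containing \<open>x\<close>. The division by
  \<open>[:1, -2:] = 1 - 2t\<close> is exact, since the dividend vanishes at \<open>t = 1/2\<close>.
\<close>

definition P :: "nat \<Rightarrow> 'a::field_char_0 \<Rightarrow> 'a poly" where
  "P r x = [:0, 1:] ^ r * [:1, -1:] ^ r
             - smult x (([:1, -1:] ^ (r + 1) - [:0, 1:] ^ (r + 1)) div [:1, -2:])"

text \<open>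
  A Puiseux series in \<open>x\<close> with exponents in \<open>(1/N)\<int>\<close> is a Laurent series in \<open>X = x\<^bsup>1/N\<^esup>\<close>,
  so that \<open>x\<close> becomes \<open>X\<^sup>N\<close>. It tends to \<open>0\<close> for \<open>x \<rightarrow> 0\<close> iff all its exponents are positive.
\<close>

definition puiseux_x :: "nat \<Rightarrow> complex fls" where
  "puiseux_x N = fls_X ^ N"

definition small_zeroes :: "nat \<Rightarrow> nat \<Rightarrow> complex fls set" where
  "small_zeroes N r = {t. poly (P r (puiseux_x N)) t = 0 \<and> (\<forall>n\<le>0. fls_nth t n = 0)}"

text \<open>The series \<open>\<Sum>k\<ge>1. tr k r * x\<^sup>k\<close>, first in \<open>x\<close>, then as a Laurent series in \<open>x\<^bsup>1/N\<^esup>\<close>.\<close>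

definition tr_gf :: "nat \<Rightarrow> complex fps" where
  "tr_gf r = Abs_fps (\<lambda>k. if k = 0 then 0 else tr k r)"

definition tr_gf_puiseux :: "nat \<Rightarrow> nat \<Rightarrow> complex fls" where
  "tr_gf_puiseux N r = fps_to_fls (fps_compose (tr_gf r) (fps_X ^ N))"

end

theory Submission
  imports Defs
begin

text \<open>
  Write \<open>q(t) = ((1 - t)\<^sup>r\<^sup>+\<^sup>1 - t\<^sup>r\<^sup>+\<^sup>1) / (1 - 2t)\<close>, a polynomial with \<open>q(0) = 1\<close>. Then
  \<open>t\<^sup>r (1 - t)\<^sup>r / q(t) = f(t)\<^sup>r\<close> for a power series \<open>f = t v(t)\<close> with \<open>v(0) = 1\<close>, so the small zeroes
  are \<open>T(c x\<^bsup>1/r\<^esup>)\<close>, where \<open>T\<close> is the compositional inverse of \<open>f\<close> and \<open>c\<close> runs over the \<open>r\<close>-th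
  roots of unity. Differentiating \<open>P\<^sub>r(x; t(x)) = 0\<close> turns the summand at such a zero \<open>t\<close> into
  \<open>x t' (1 - 2t)\<^sup>2\<close>, and the sum over \<open>c\<close> selects the coefficients of \<open>X T' (1 - 2T)\<^sup>2\<close> whose index is
  divisible by \<open>r\<close>. On the other side, Cauchy's formula makes \<open>tr k r\<close> equal to \<open>-1/2\<close> times the residue
  of \<open>(1 - 2t)\<^sup>2 / f\<^sup>r\<^sup>k\<close> at \<open>0\<close>; substituting \<open>t = T(X)\<close> (Lagrange inversion) yields the same coefficients.
\<close>

section \<open>Coefficients of compositions and Lagrange inversion\<close>

text \<open>Since \<open>f ^ j\<close> has no terms below degree \<open>j\<close>, the inner sums of
  the composition can all be run up to the same bound \<open>n\<close>, after which the two
  summations can be swapped.\<close>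

lemma fps_nth_mult_compose:
  fixes K f W :: "'a::idom fps"
  assumes "fps_nth f 0 = 0"
  shows "fps_nth ((K oo f) * W) n = (\<Sum>j\<le>n. fps_nth K j * fps_nth (f ^ j * W) n)"
proof -
  have "fps_nth (K oo f) i = (\<Sum>j\<le>n. fps_nth K j * fps_nth (f ^ j) i)" if "i \<le> n" for i
    unfolding fps_compose_nth atLeast0AtMost
    using that assms by (intro sum.mono_neutral_left) (auto simp: startsby_zero_power_prefix)
  then have "fps_nth ((K oo f) * W) n
      = (\<Sum>i\<le>n. (\<Sum>j\<le>n. fps_nth K j * fps_nth (f ^ j) i) * fps_nth W (n - i))"
    by (simp add: fps_mult_nth atLeast0AtMost)
  also have "\<dots> = (\<Sum>j\<le>n. fps_nth K j * (\<Sum>i\<le>n. fps_nth (f ^ j) i * fps_nth W (n - i)))"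
    unfolding sum_distrib_left sum_distrib_right by (subst sum.swap) (simp add: mult.assoc)
  finally show ?thesis
    by (simp add: fps_mult_nth atLeast0AtMost)
qed

text \<open>With \<open>f = X v\<close> this is the residue of \<open>f' / f^(m+1)\<close>, shifted
  by \<open>X^(m+1)\<close> to stay within power series: 1 for the logarithmic derivative, and 0
  otherwise because \<open>m f' / f^(m+1)\<close> is the derivative of
  \<open>- f^(-m)\<close>.\<close>

lemma fps_nth_deriv_X_mult_inverse_power:
  fixes v :: "'a::field_char_0 fps"
  assumes "fps_nth v 0 \<noteq> 0"
  shows "fps_nth (fps_deriv (fps_X * v) * inverse v ^ Suc m) m = (if m = 0 then 1 else 0)"
proof -
  define w where "w = inverse v ^ m"
  have vv: "inverse v * v = 1"
    using assms by (simp add: inverse_mult_eq_1)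
  have "fps_const (of_nat m) * (fps_deriv (fps_X * v) * inverse v ^ Suc m)
      = fps_const (of_nat m) * (inverse v * v) * w + fps_X * (fps_const (of_nat m) * fps_deriv v * inverse v ^ Suc m)"
    by (simp add: w_def algebra_simps)
  also have "fps_const (of_nat m) * fps_deriv v * inverse v ^ Suc m = - fps_deriv w"
    unfolding w_def fps_deriv_power
    by (cases m) (simp_all add: fps_inverse_deriv[OF assms] power2_eq_square algebra_simps)
  finally have *: "fps_const (of_nat m) * (fps_deriv (fps_X * v) * inverse v ^ Suc m)
      = fps_const (of_nat m) * w - fps_X * fps_deriv w"
    by (simp add: vv)
  show ?thesis
  proof (cases m)
    case 0
    then show ?thesis using assms by simp
  next
    case (Suc m')
    \<comment> \<open>Coefficient \<open>m\<close> of \<open>m w - X w'\<close> is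
      \<open>m w_m - m w_m\<close>.\<close>
    have "of_nat m * fps_nth (fps_deriv (fps_X * v) * inverse v ^ Suc m) m = 0"
      using arg_cong[OF *, of "\<lambda>f. fps_nth f m"] Suc by simp
    then show ?thesis
      using Suc by (simp del: of_nat_Suc power_Suc)
  qed
qed

text \<open>Change of variable in a residue: \<open>s = f = X v\<close> turns
  \<open>K(s) / s^(n+1)\<close> into \<open>K(f) f' / f^(n+1)\<close>. When \<open>K\<close> is
  expanded in powers of \<open>f\<close>, only the term \<open>j = n\<close> has a residue.\<close>

lemma fps_Lagrange_coefficient:
  fixes K v :: "'a::field_char_0 fps"
  assumes "fps_nth v 0 \<noteq> 0"
  shows "fps_nth ((K oo (fps_X * v)) * fps_deriv (fps_X * v) * inverse v ^ Suc n) n = fps_nth K n"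
proof -
  have vv: "v * inverse v = 1"
    using assms by (simp add: inverse_mult_eq_1')
  have "fps_nth ((fps_X * v) ^ j * (fps_deriv (fps_X * v) * inverse v ^ Suc n)) n = (if j = n then 1 else 0)"
    if "j \<le> n" for j
  proof -
    have n: "Suc n = j + Suc (n - j)" using that by simp
    \<comment> \<open>The power \<open>(X v)^j\<close> cancels \<open>j\<close> of the factors
      \<open>inverse v\<close> and leaves \<open>X^j\<close>, which lowers the index to
      \<open>n - j\<close>.\<close>
    have eq: "(fps_X * v) ^ j * (fps_deriv (fps_X * v) * inverse v ^ Suc n)
        = fps_X ^ j * ((v * inverse v) ^ j * (fps_deriv (fps_X * v) * inverse v ^ Suc (n - j)))"
      by (subst n) (simp only: power_add power_mult_distrib mult_ac)
    show ?thesis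
      unfolding eq vv power_one mult_1_left fps_X_power_mult_nth
      using that fps_nth_deriv_X_mult_inverse_power[OF assms, of "n - j"] by auto
  qed
  then have "(\<Sum>j\<le>n. fps_nth K j * fps_nth ((fps_X * v) ^ j * (fps_deriv (fps_X * v) * inverse v ^ Suc n)) n)
      = (\<Sum>j\<le>n. if j = n then fps_nth K j else 0)"
    by (intro sum.cong) (simp_all del: power_Suc fps_deriv_mult)
  then show ?thesis
    by (simp add: fps_nth_mult_compose mult.assoc del: power_Suc fps_deriv_mult)
qed

section \<open>Sums over roots of unity\<close>

lemma sum_power_roots_unity:
  assumes "r > 0"
  shows "(\<Sum>c | c ^ r = (1::complex). c ^ n) = (if r dvd n then of_nat r else 0)"
proof (cases "r dvd n")
  case True
  then have "c ^ n = 1" if "c ^ r = 1" for c :: complex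
    using that by (auto simp: power_mult)
  then have "(\<Sum>c | c ^ r = (1::complex). c ^ n) = (\<Sum>c | c ^ r = (1::complex). 1)"
    by (intro sum.cong) auto
  then show ?thesis
    using True card_roots_unity_eq[OF assms] by simp
next
  case False
  define w where "w = cis (2 * pi / real r)"
  have wpow: "w ^ k = cis (2 * pi * real k / real r)" for k
    by (simp add: w_def Complex.DeMoivre mult_ac)
  have wr: "w ^ r = 1"
    using assms by (simp add: wpow)
  have "w ^ (n mod r) \<noteq> w ^ 0"
    using bij_betw_imp_inj_on[OF Complex.bij_betw_roots_unity[OF assms]] False assms
    unfolding wpow inj_on_def by (metis lessThan_iff mod_less_divisor mod_0_imp_dvd)
  moreover have "w ^ n = w ^ (n mod r)"
    using arg_cong[OF mult_div_mod_eq[of r n], of "(^) w"]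
    by (simp only: power_add power_mult wr power_one mult_1_left)
  ultimately have wn: "w ^ n \<noteq> 1" by simp
  have w0: "w \<noteq> 0"
    by (simp add: w_def)
  \<comment> \<open>Multiplication by the primitive root \<open>w\<close> permutes the roots, yet
    scales the sum by \<open>w ^ n\<close>; as \<open>w ^ n\<close> is not 1, the sum is 0.\<close>
  have "bij_betw (\<lambda>c. w * c) {c. c ^ r = 1} {c. c ^ r = 1}"
    by (rule bij_betwI[where g = "\<lambda>c. c / w"])
       (auto simp: power_mult_distrib power_divide wr w0)
  from sum.reindex_bij_betw[OF this, of "\<lambda>c. c ^ n"]
  have "(\<Sum>c | c ^ r = 1. c ^ n) = (\<Sum>c | c ^ r = 1. (w * c) ^ n)"
    by simp
  also have "\<dots> = w ^ n * (\<Sum>c | c ^ r = 1. c ^ n)"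
    by (simp add: power_mult_distrib sum_distrib_left)
  finally show ?thesis
    using wn False by simp
qed

text \<open>Substituting \<open>c X^m\<close> multiplies coefficient \<open>k\<close> by
  \<open>c^k\<close> and moves it to degree \<open>k m\<close>, so summing over \<open>c\<close>
  keeps exactly the \<open>k\<close> divisible by \<open>r\<close>.\<close>

lemma sum_compose_roots_unity:
  fixes f :: "complex fps"
  assumes "r > 0" and "m > 0"
  shows "(\<Sum>c | c ^ r = 1. f oo (fps_const c * fps_X ^ m)) = of_nat r * (Abs_fps (\<lambda>k. fps_nth f (r * k)) oo fps_X ^ (r * m))"
proof -
  have "f oo (fps_const c * fps_X ^ m) = (f oo (fps_const c * fps_X)) oo fps_X ^ m" for c
    using assms by (subst fps_compose_assoc[symmetric]) (simp_all add: fps_compose_mult_distrib)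
  then have "fps_nth (\<Sum>c | c ^ r = 1. f oo (fps_const c * fps_X ^ m)) n
      = (if m dvd n then (\<Sum>c | c ^ r = 1. c ^ (n div m)) * fps_nth f (n div m) else 0)" for n
    using assms by (simp add: fps_sum_nth fps_nth_compose_X_power sum_distrib_right)
  moreover have "m dvd n \<and> r dvd n div m \<longleftrightarrow> r * m dvd n" for n
    using assms by (metis dvd_div_iff_mult dvd_mult_right not_gr_zero mult.commute)
  ultimately show ?thesis
    using assms
    by (auto simp: fps_eq_iff fps_nth_compose_X_power sum_power_roots_unity fps_of_nat[symmetric] simp del: fps_of_nat)
qed

section \<open>The quotient \<open>q\<close>, the polynomial \<open>P\<close> and implicit
  differentiation\<close>

text \<open>The exact quotient of \<open>(1 - t)^(r+1) - t^(r+1)\<close> by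
  \<open>1 - 2t = (1 - t) - t\<close>, as a geometric sum without division, so that \<open>t\<close>
  may be a number, a polynomial or a formal series.\<close>

definition q :: "nat \<Rightarrow> 'a::comm_ring_1 \<Rightarrow> 'a" where
  "q r t = (\<Sum>i\<le>r. (1 - t) ^ i * t ^ (r - i))"

lemma one_minus_two_mult_q: "(1 - 2 * t) * q r t = (1 - t) ^ (r + 1) - t ^ (r + 1)"
proof -
  have "1 - t - t = 1 - 2 * t" by simp
  moreover have "(\<Sum>i<Suc r. t ^ (r - i) * (1 - t) ^ i) = q r t"
    by (simp add: q_def lessThan_Suc_atMost mult.commute)
  ultimately show ?thesis
    using power_diff_sumr2[of "1 - t" "Suc r" t] by simp
qed

lemma P_eq: "P r x = [:0, 1:] ^ r * (1 - [:0, 1:]) ^ r - smult x (q r [:0, 1:])"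
proof -
  have "1 - [:0, 1:] = [:1, -1 :: 'a:]" "1 - 2 * [:0, 1:] = [:1, -2 :: 'a:]"
    by (simp_all add: one_pCons numeral_poly)
  then show ?thesis
    using one_minus_two_mult_q[of "[:0, 1:] :: 'a poly" r]
    unfolding P_def by (metis nonzero_mult_div_cancel_left one_pCons pCons_eq_0_iff zero_neq_one)
qed

lemma poly_q: "poly (q r p) t = q r (poly p t)"
  by (simp add: q_def poly_sum)

lemma poly_P: "poly (P r x) t = t ^ r * (1 - t) ^ r - x * q r t"
  by (simp add: P_eq poly_q)

lemma pderiv_sum: "pderiv (sum f A) = (\<Sum>i\<in>A. pderiv (f i))"
  by (induction A rule: infinite_finite_induct) (simp_all add: pderiv_add)

lemma fls_deriv_sum: "fls_deriv (sum f A) = (\<Sum>i\<in>A. fls_deriv (f i))"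
  by (induction A rule: infinite_finite_induct) simp_all

lemma fls_deriv_one_minus_power_mult_power:
  fixes t :: "'a::field_char_0 fls"
  shows "fls_deriv ((1 - t) ^ i * t ^ j) = poly (pderiv ((1 - [:0, 1:]) ^ i * [:0, 1:] ^ j)) t * fls_deriv t"
  by (cases i; cases j)
     (simp_all add: fls_deriv_power pderiv_mult pderiv_power_Suc pderiv_diff pderiv_pCons algebra_simps del: power_Suc)

lemma fls_deriv_q:
  fixes t :: "'a::field_char_0 fls"
  shows "fls_deriv (q r t) = poly (pderiv (q r [:0, 1:])) t * fls_deriv t"
  by (simp add: q_def fls_deriv_sum pderiv_sum poly_sum sum_distrib_right fls_deriv_one_minus_power_mult_power
      del: fls_deriv_mult)

text \<open>Implicit differentiation of \<open>t^r (1 - t)^r = x q(t)\<close>: the term with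
  \<open>q'(t) t'\<close> moves to the left and completes the derivative of \<open>P r x\<close>,
  leaving \<open>x' q(t)\<close>.\<close>

lemma poly_pderiv_P_mult_deriv:
  fixes x t :: "'a::field_char_0 fls"
  assumes "poly (P r x) t = 0"
  shows "poly (pderiv (P r x)) t * fls_deriv t = fls_deriv x * q r t"
proof -
  have "fls_deriv ((1 - t) ^ r * t ^ r) = fls_deriv (x * q r t)"
    using assms by (simp add: poly_P mult.commute)
  then show ?thesis
    using fls_deriv_one_minus_power_mult_power[of t r r]
    by (simp add: P_eq pderiv_diff pderiv_smult fls_deriv_q mult.commute algebra_simps)
qed

lemma fps_to_fls_sum: "fps_to_fls (sum f A) = (\<Sum>i\<in>A. fps_to_fls (f i))"
  by (induction A rule: infinite_finite_induct) simp_all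

lemma fps_to_fls_q: "fps_to_fls (q r t) = q r (fps_to_fls t)"
  by (simp add: q_def fps_to_fls_sum fls_times_fps_to_fls fps_to_fls_power)

lemma q_compose:
  fixes f :: "'a::idom fps"
  assumes "fps_nth g 0 = 0"
  shows "q r f oo g = q r (f oo g)"
  using assms
  by (simp add: q_def fps_compose_sum_distrib fps_compose_mult_distrib fps_compose_power[symmetric] fps_compose_sub_distrib)

lemma fps_nth_0_power: "fps_nth (f ^ n) 0 = (fps_nth f 0 :: 'a::comm_semiring_1) ^ n"
  by (induction n) simp_all

lemma q_nth_0: "fps_nth T 0 = 0 \<Longrightarrow> fps_nth (q r T) 0 = 1"
  by (simp add: q_def fps_sum_nth fps_nth_0_power power_0_left if_distrib cong: if_cong)


section \<open>The contour integral as a power series coefficient\<close>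

text \<open>The quotient \<open>(1 - X)^r / q(X)\<close> has constant term 1, hence an
  \<open>r\<close>-th root \<open>v\<close>; \<open>X v\<close> is the series whose inverse
  parametrises the small zeroes.\<close>

lemma ex_root_of_unit:
  assumes "r > 0"
  obtains v :: "complex fps" where "fps_nth v 0 = 1" "v ^ r * q r fps_X = (1 - fps_X) ^ r"
proof
  define u :: "complex fps" where "u = (1 - fps_X) ^ r * inverse (q r fps_X)"
  have u0: "fps_nth u 0 = 1"
    by (simp add: u_def fps_nth_0_power q_nth_0)
  obtain r' where r': "r = Suc r'"
    using assms gr0_implies_Suc by blast
  \<comment> \<open>The function \<open>\<lambda>_ _. 1\<close> has to supply an \<open>r\<close>-th
    root of the constant coefficient of \<open>u\<close>, which is 1.\<close>
  show "fps_nth (fps_radical (\<lambda>_ _. 1) r u) 0 = 1"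
    using assms by simp
  have "fps_radical (\<lambda>_ _. 1) r u ^ r = u"
    using power_radical[of u "\<lambda>_ _. 1" r'] by (simp add: u0 r' del: power_Suc)
  then show "fps_radical (\<lambda>_ _. 1) r u ^ r * q r fps_X = (1 - fps_X) ^ r"
    by (simp add: u_def mult.assoc inverse_mult_eq_1 q_nth_0)
qed

text \<open>The \<open>k\<close> factors \<open>1 - 2t\<close> of the numerator against exponent
  \<open>k - 2\<close> in the denominator leave \<open>(1 - 2t)^2\<close>. What remains is a
  function analytic near 0 over \<open>t^(r k)\<close>, so Cauchy's formula reads off a Taylor
  coefficient; \<open>-1/(4 pi i)\<close> times \<open>2 pi i\<close> gives
  \<open>-1/2\<close>.\<close>

lemma tr_eq_coefficient:
  fixes v :: "complex fps"
  assumes "k > 0" "r > 0"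
    and v: "fps_nth v 0 = 1" "v ^ r * q r fps_X = (1 - fps_X) ^ r"
  shows "tr k r = - fps_nth ((1 - 2 * fps_X) ^ 2 * inverse v ^ (r * k)) (r * k - 1) / 2"
proof -
  define f :: "complex \<Rightarrow> complex" where
    "f t = (1 - 2 * t) ^ 2 * (q r t ^ k * inverse ((1 - t) ^ (r * k)))" for t
  define F :: "complex fps" where
    "F = (1 - 2 * fps_X) ^ 2 * (q r fps_X ^ k * inverse ((1 - fps_X) ^ (r * k)))"
  \<comment> \<open>A denominator \<open>t^(r k)\<close> selects the coefficient one index lower;
    \<open>r * k > 0\<close> makes the natural subtraction exact.\<close>
  define n where "n = r * k - 1"
  have n: "Suc n = r * k"
    using assms by (simp add: n_def)
  have "v ^ (r * k) * q r fps_X ^ k = (1 - fps_X) ^ (r * k)"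
    using arg_cong[OF v(2), of "\<lambda>w. w ^ k"] by (simp add: power_mult power_mult_distrib)
  then have "inverse v ^ (r * k) * v ^ (r * k) * (q r fps_X ^ k * inverse ((1 - fps_X) ^ (r * k)))
      = inverse v ^ (r * k) * ((1 - fps_X) ^ (r * k) * inverse ((1 - fps_X) ^ (r * k)))"
    by (simp only: mult.assoc[symmetric]) (simp add: mult.assoc)
  moreover have "inverse v ^ (r * k) * v ^ (r * k) = 1"
    using v by (simp add: inverse_mult_eq_1 flip: power_mult_distrib)
  ultimately have "F = (1 - 2 * fps_X) ^ 2 * inverse v ^ (r * k)"
    unfolding F_def by (simp add: fps_nth_0_power inverse_mult_eq_1')
  moreover have "f has_fps_expansion F"
    unfolding f_def F_def q_def by (intro fps_expansion_intros) (simp add: fps_nth_0_power)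
  ultimately have coeff: "(deriv ^^ n) f 0 / fact n
      = fps_nth ((1 - 2 * fps_X) ^ 2 * inverse v ^ (r * k)) n"
    by (simp add: fps_nth_fps_expansion)
  have holo: "f holomorphic_on cball 0 (1/4)"
    unfolding f_def q_def by (intro holomorphic_intros) (auto simp: dist_norm)
  have "contour_integral (circlepath 0 (1/4))
       (\<lambda>t. ((1 - t) ^ (r + 1) - t ^ (r + 1)) ^ k /
            (t ^ (r * k) * (1 - t) ^ (r * k) * (1 - 2 * t) powi (int k - 2)))
    = contour_integral (circlepath 0 (1/4)) (\<lambda>t. f t / (t - 0) ^ Suc n)"
  proof (rule contour_integral_cong)
    fix t :: complex
    assume "t \<in> path_image (circlepath 0 (1/4))"
    moreover have "1/2 \<notin> path_image (circlepath (0::complex) (1/4))"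
      by (simp add: norm_divide)
    ultimately have "t \<noteq> 1/2"
      by metis
    then have t: "1 - 2 * t \<noteq> 0"
      by (auto simp: mult.commute)
    have pw: "(1 - 2 * t) powi (int k - 2) = (1 - 2 * t) ^ k / (1 - 2 * t) ^ 2"
      using t by (simp add: power_int_diff)
    then show "((1 - t) ^ (r + 1) - t ^ (r + 1)) ^ k /
            (t ^ (r * k) * (1 - t) ^ (r * k) * (1 - 2 * t) powi (int k - 2))
         = f t / (t - 0) ^ Suc n"
      unfolding one_minus_two_mult_q[symmetric] pw f_def n power_mult_distrib
      using t by (simp add: divide_simps)
  qed simp
  also have "\<dots> = 2 * of_real pi * \<i> * (deriv ^^ n) f 0 / fact n"
    using Cauchy_contour_integral_circlepath[OF holomorphic_on_imp_continuous_on[OF holo]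
        holomorphic_on_subset[OF holo ball_subset_cball], of 0 n] by simp
  finally show ?thesis
    unfolding tr_def n_def[symmetric] coeff[symmetric] by (simp add: divide_simps mult_ac)
qed

section \<open>Parametrisation of the small zeroes\<close>

text \<open>A Laurent series with only positive exponents is a power series without constant term,
  so composition becomes available.\<close>

lemma small_zeroes_iff:
  assumes "N > 0"
  shows "t \<in> small_zeroes N r \<longleftrightarrow>
    (\<exists>T. t = fps_to_fls T \<and> fps_nth T 0 = 0 \<and> T ^ r * (1 - T) ^ r = fps_X ^ N * q r T)"
proof -
  have *: "poly (P r (puiseux_x N)) (fps_to_fls T) = 0 \<longleftrightarrow> T ^ r * (1 - T) ^ r = fps_X ^ N * q r T" for T
  proof -
    have "poly (P r (puiseux_x N)) (fps_to_fls T) = fps_to_fls (T ^ r * (1 - T) ^ r - fps_X ^ N * q r T)"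
      by (simp add: poly_P puiseux_x_def fls_times_fps_to_fls fps_to_fls_power fps_to_fls_q)
    then show ?thesis
      by (simp del: fps_to_fls_minus)
  qed
  have "\<exists>T. t = fps_to_fls T \<and> fps_nth T 0 = 0" if "\<forall>n\<le>0. fls_nth t n = 0" for t :: "complex fls"
  proof (intro exI conjI)
    show "t = fps_to_fls (fls_regpart t)"
      using that by (auto simp: fls_eq_iff)
    show "fps_nth (fls_regpart t) 0 = 0"
      using that by simp
  qed
  then show ?thesis
    unfolding small_zeroes_def using * by (auto, metis)
qed

text \<open>The polynomial \<open>Y^r - X^(r m)\<close> has degree \<open>r\<close> in
  \<open>Y\<close> over an integral domain, hence at most \<open>r\<close> roots, and the
  \<open>c X^m\<close> are already \<open>r\<close> different ones.\<close>

lemma fps_power_eq_X_power_iff: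
  fixes f :: "complex fps"
  assumes "r > 0"
  shows "f ^ r = fps_X ^ (r * m) \<longleftrightarrow> (\<exists>c. c ^ r = 1 \<and> f = fps_const c * fps_X ^ m)"
proof -
  define p where "p = [:0, 1:] ^ r + [:- (fps_X ^ (r * m)) :: complex fps:]"
  have deg: "degree ([:0, 1 :: complex fps:] ^ r) = r"
    by (simp add: degree_power_eq)
  have dp: "degree p = r"
    unfolding p_def using assms deg by (subst degree_add_eq_left) simp_all
  have p: "poly p f = 0 \<longleftrightarrow> f ^ r = fps_X ^ (r * m)" for f
    by (simp add: p_def)
  have p0: "p \<noteq> 0"
    using dp assms by auto
  let ?g = "\<lambda>c :: complex. fps_const c * fps_X ^ m"
  have sub: "?g ` {c. c ^ r = 1} \<subseteq> {f. poly p f = 0}"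
    by (auto simp: p power_mult_distrib fps_const_power mult.commute power_mult[symmetric])
  have inj: "inj_on ?g {c. c ^ r = 1}"
    by (auto simp: inj_on_def)
  have "?g ` {c. c ^ r = 1} = {f. poly p f = 0}"
  proof (rule card_seteq[OF _ sub])
    show "finite {f. poly p f = 0}"
      by (rule poly_roots_finite[OF p0])
    show "card {f. poly p f = 0} \<le> card (?g ` {c. c ^ r = 1})"
      using card_poly_roots_bound[OF p0] dp card_roots_unity_eq[OF assms]
      by (simp add: card_image[OF inj])
  qed
  then show ?thesis
    using p by blast
qed

lemma compose_eq_iff_eq_inv_compose:
  fixes f g h :: "'a::field fps"
  assumes f: "fps_nth f 0 = 0" "fps_nth f 1 \<noteq> 0" and "fps_nth g 0 = 0" "fps_nth h 0 = 0"
  shows "f oo g = h \<longleftrightarrow> g = fps_inv f oo h"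
proof
  assume "f oo g = h"
  then show "g = fps_inv f oo h"
    using fps_inv[OF f] fps_compose_assoc[of g f "fps_inv f"] assms by auto
next
  have "fps_nth (fps_inv f) 0 = 0"
    by (simp add: fps_inv_def)
  moreover assume "g = fps_inv f oo h"
  ultimately show "f oo g = h"
    using fps_inv_right[OF f] fps_compose_assoc[of h "fps_inv f" f] assms by auto
qed

text \<open>Cancelling the nonzero \<open>q(T)\<close> turns the root equation into
  \<open>f(T)^r = X^(r m)\<close> with \<open>f = X v\<close>. Hence \<open>f(T) = c X^m\<close>
  with \<open>c^r = 1\<close>, which the inverse of \<open>f\<close> solves for
  \<open>T\<close>.\<close>

lemma small_zeroes_eq:
  fixes v :: "complex fps"
  assumes "r > 0" "m > 0"
    and v: "fps_nth v 0 = 1" "v ^ r * q r fps_X = (1 - fps_X) ^ r"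
  shows "small_zeroes (r * m) r
    = (\<lambda>c. fps_to_fls (fps_inv (fps_X * v) oo (fps_const c * fps_X ^ m))) ` {c. c ^ r = 1}"
proof -
  define f where "f = fps_X * v"
  have f: "fps_nth f 0 = 0" "fps_nth f 1 \<noteq> 0"
    using v by (simp_all add: f_def)
  have inv0: "fps_nth (fps_inv f oo (fps_const c * fps_X ^ m)) 0 = 0" for c
    by (simp add: fps_inv_def)
  have fr: "f ^ r * q r fps_X = fps_X ^ r * (1 - fps_X) ^ r"
    using v by (simp add: f_def power_mult_distrib mult.assoc)
  have "T ^ r * (1 - T) ^ r = fps_X ^ (r * m) * q r T \<longleftrightarrow>
      (\<exists>c. c ^ r = 1 \<and> T = fps_inv f oo (fps_const c * fps_X ^ m))" if T: "fps_nth T 0 = 0" for T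
  proof -
    have "(f oo T) ^ r * q r T = T ^ r * (1 - T) ^ r"
      using arg_cong[OF fr, of "\<lambda>g. g oo T"] T
      by (simp add: fps_compose_mult_distrib fps_compose_power[symmetric] q_compose fps_compose_sub_distrib)
    moreover have "q r T \<noteq> 0"
      using q_nth_0[OF T, of r] by auto
    ultimately have "T ^ r * (1 - T) ^ r = fps_X ^ (r * m) * q r T \<longleftrightarrow> (f oo T) ^ r = fps_X ^ (r * m)"
      by (metis mult_right_cancel)
    then show ?thesis
      using assms T by (simp add: fps_power_eq_X_power_iff compose_eq_iff_eq_inv_compose[OF f])
  qed
  then show ?thesis
    using assms inv0 unfolding f_def[symmetric] by (auto simp: small_zeroes_iff)
qed

section \<open>The summand at a small zero\<close>

text \<open>Derivatives are taken in \<open>X = x^(1/N)\<close>; the factor \<open>N\<close> comes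
  from \<open>X x' = N x\<close> for \<open>x = X^N\<close>. Together with implicit differentiation
  this eliminates \<open>q(t)\<close> and the derivative of \<open>P\<close>.\<close>

lemma small_zero_term:
  fixes T :: "complex fps"
  assumes "N > 0" "fps_nth T 0 = 0" "fps_to_fls T \<in> small_zeroes N r"
  defines "t \<equiv> fps_to_fls T"
  shows "of_nat N * (t ^ r * (1 - t) ^ r * (1 - 2 * t) ^ 2 / poly (pderiv (P r (puiseux_x N))) t)
    = fps_to_fls (fps_X * fps_deriv T * (1 - 2 * T) ^ 2)"
proof -
  define x where "x = puiseux_x N"
  have root: "poly (P r x) t = 0"
    using assms by (simp add: small_zeroes_def x_def)
  have D: "t ^ r * (1 - t) ^ r = x * q r t"
    using root by (simp add: poly_P)
  have q0: "q r t \<noteq> 0"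
    using q_nth_0[OF assms(2), of r] unfolding t_def fps_to_fls_q[symmetric] by auto
  have dx: "fls_X * fls_deriv x = of_nat N * x"
    using power_minus_mult[OF assms(1), of "fls_X :: complex fls"]
    by (simp add: x_def puiseux_x_def fls_deriv_power mult_ac)
  have "x \<noteq> 0"
    by (simp add: x_def puiseux_x_def)
  then have dx0: "fls_deriv x \<noteq> 0"
    using dx assms(1) by auto
  have P': "poly (pderiv (P r x)) t * fls_deriv t = fls_deriv x * q r t"
    by (rule poly_pderiv_P_mult_deriv[OF root])
  \<comment> \<open>The root is simple, so the division is genuine and not the default value
    0.\<close>
  then have "poly (pderiv (P r x)) t \<noteq> 0"
    using dx0 q0 by auto
  then have "of_nat N * (x * q r t * (1 - 2 * t) ^ 2 / poly (pderiv (P r x)) t)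
      = fls_X * (fls_deriv x * q r t) * (1 - 2 * t) ^ 2 / poly (pderiv (P r x)) t"
    using dx by (simp add: mult.assoc[symmetric])
  also have "\<dots> = fls_X * fls_deriv t * (1 - 2 * t) ^ 2"
    unfolding P'[symmetric] using \<open>poly (pderiv (P r x)) t \<noteq> 0\<close> by (simp add: field_simps)
  also have "\<dots> = fps_to_fls (fps_X * fps_deriv T * (1 - 2 * T) ^ 2)"
    by (simp add: t_def fls_times_fps_to_fls fps_to_fls_power fls_deriv_fps_to_fls)
  finally show ?thesis
    unfolding D[symmetric] x_def[symmetric] .
qed

text \<open>The operator \<open>X d/dX\<close> multiplies \<open>c X^m\<close> by \<open>m\<close>;
  the rest is the chain rule.\<close>

lemma compose_const_X_power_deriv:
  fixes f :: "complex fps"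
  assumes "m > 0"
  defines "Y c \<equiv> fps_const c * fps_X ^ m"
  shows "fps_X * fps_deriv (f oo Y c) = of_nat m * ((fps_X * fps_deriv f) oo Y c)"
proof -
  have Y0: "fps_nth (Y c) 0 = 0"
    using assms by simp
  have "fps_X * fps_deriv (Y c) = of_nat m * Y c"
    using power_minus_mult[OF assms(1), of "fps_X :: complex fps"]
    by (simp add: Y_def fps_deriv_power' mult_ac)
  then show ?thesis
    using Y0 by (simp add: fps_compose_deriv fps_compose_mult_distrib mult_ac)
qed

section \<open>The generating function by Lagrange inversion\<close>

text \<open>Lagrange inversion is applied to \<open>K = T' (1 - 2T)^2\<close>: from
  \<open>T(f) = X\<close> follows \<open>T'(f) f' = 1\<close>, so
  \<open>K(f) f' = (1 - 2X)^2\<close>, the series in the formula for \<open>tr\<close>.\<close>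

lemma tr_gf_eq:
  fixes v :: "complex fps"
  assumes "r > 0"
    and v: "fps_nth v 0 = 1" "v ^ r * q r fps_X = (1 - fps_X) ^ r"
  defines "T \<equiv> fps_inv (fps_X * v)"
  shows "tr_gf r = fps_const (- (1/2)) * Abs_fps (\<lambda>k. fps_nth (fps_X * fps_deriv T * (1 - 2 * T) ^ 2) (r * k))"
proof -
  define f where "f = fps_X * v"
  have f: "fps_nth f 0 = 0" "fps_nth f 1 \<noteq> 0"
    using v by (simp_all add: f_def)
  have Tf: "T oo f = fps_X"
    using fps_inv[OF f] by (simp add: T_def f_def)
  have "(fps_deriv T oo f) * fps_deriv f = 1"
    using arg_cong[OF Tf, of fps_deriv] f by (simp add: fps_compose_deriv)
  moreover have "(fps_deriv T * (1 - 2 * T) ^ 2) oo f = (fps_deriv T oo f) * (1 - 2 * fps_X) ^ 2"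
    using f by (simp add: fps_compose_mult_distrib fps_compose_power[symmetric] fps_compose_sub_distrib Tf
        fps_numeral_fps_const)
  ultimately have K: "((fps_deriv T * (1 - 2 * T) ^ 2) oo f) * fps_deriv f = (1 - 2 * fps_X) ^ 2"
    by (simp add: mult_ac)
  have "tr k r = - fps_nth (fps_deriv T * (1 - 2 * T) ^ 2) (r * k - 1) / 2" if "k > 0" for k
  proof -
    have "r * k = Suc (r * k - 1)"
      using that assms by simp
    then have "fps_nth ((1 - 2 * fps_X) ^ 2 * inverse v ^ (r * k)) (r * k - 1)
        = fps_nth (fps_deriv T * (1 - 2 * T) ^ 2) (r * k - 1)"
      using fps_Lagrange_coefficient[of v "fps_deriv T * (1 - 2 * T) ^ 2" "r * k - 1"] v K
      unfolding f_def by simp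
    then show ?thesis
      using tr_eq_coefficient[OF that assms(1) v] by simp
  qed
  \<comment> \<open>The factor \<open>X\<close> shifts index \<open>r * k - 1\<close> to
    \<open>r * k\<close> and gives coefficient 0 at \<open>k = 0\<close>, as in
    \<open>tr_gf\<close>.\<close>
  then show ?thesis
    using assms(1) by (auto simp: tr_gf_def fps_eq_iff mult.assoc)
qed

section \<open>Summation over the small zeroes\<close>

theorem theorem3p1:
  fixes r N :: nat
  assumes "r \<ge> 2" and "N > 0" and "r dvd N"
  shows "card (small_zeroes N r) = r \<and>
    tr_gf_puiseux N r =
      - (1/2) * (\<Sum>t\<in>small_zeroes N r.
        t ^ r * (1 - t) ^ r * (1 - 2 * t) ^ 2 / poly (pderiv (P r (puiseux_x N))) t)"
proof -
  have r: "r > 0"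
    using assms by simp
  obtain m where N: "N = r * m"
    using assms by blast
  have m: "m > 0"
    using assms N by simp
  obtain v :: "complex fps" where v: "fps_nth v 0 = 1" "v ^ r * q r fps_X = (1 - fps_X) ^ r"
    using ex_root_of_unit[OF r] by blast
  define T where "T = fps_inv (fps_X * v)"
  \<comment> \<open>As \<open>m = N / r\<close>, this is \<open>c x^(1/r)\<close> written in
    \<open>X = x^(1/N)\<close>.\<close>
  define Y :: "complex \<Rightarrow> complex fps" where "Y c = fps_const c * fps_X ^ m" for c
  define G where "G = fps_X * fps_deriv T * (1 - 2 * T) ^ 2"
  define h where "h = Abs_fps (\<lambda>k. fps_nth G (r * k))"
  let ?U = "{c :: complex. c ^ r = 1}"
  let ?S = "\<lambda>t. t ^ r * (1 - t) ^ r * (1 - 2 * t) ^ 2 / poly (pderiv (P r (puiseux_x N))) t"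
  have T0: "fps_nth T 0 = 0"
    by (simp add: T_def fps_inv_def)
  have Y0: "fps_nth (Y c) 0 = 0" for c
    using m by (simp add: Y_def)
  have zeroes: "small_zeroes N r = (\<lambda>c. fps_to_fls (T oo Y c)) ` ?U"
    unfolding N T_def Y_def by (rule small_zeroes_eq[OF r m v])
  \<comment> \<open>Composing with \<open>X v\<close> recovers \<open>Y c\<close>, so different
    \<open>c\<close> give different zeroes: there are \<open>r\<close> of them, and the sum over the
    set can be reindexed by \<open>c\<close>.\<close>
  have "Y c = (fps_X * v) oo (T oo Y c)" for c
    using compose_eq_iff_eq_inv_compose[of "fps_X * v" "T oo Y c" "Y c"] v T0 Y0 by (simp add: T_def)
  moreover have "c = c'" if "Y c = Y c'" for c c'
    using that by (simp add: Y_def)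
  ultimately have "inj_on (\<lambda>c. T oo Y c) ?U"
    by (intro inj_onI) metis
  then have inj: "inj_on (\<lambda>c. fps_to_fls (T oo Y c)) ?U"
    by (simp add: inj_on_def)
  have "of_nat N * ?S (fps_to_fls (T oo Y c)) = fps_to_fls (of_nat m * (G oo Y c))" if "c \<in> ?U" for c
  proof -
    have "of_nat N * ?S (fps_to_fls (T oo Y c))
        = fps_to_fls (fps_X * fps_deriv (T oo Y c) * (1 - 2 * (T oo Y c)) ^ 2)"
      using that assms T0 by (intro small_zero_term) (auto simp: zeroes)
    also have "fps_X * fps_deriv (T oo Y c) = of_nat m * ((fps_X * fps_deriv T) oo Y c)"
      unfolding Y_def by (rule compose_const_X_power_deriv[OF m])
    also have "(1 - 2 * (T oo Y c)) ^ 2 = ((1 - 2 * T) ^ 2 oo Y c)"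
      using Y0 by (simp add: fps_compose_mult_distrib fps_compose_power[symmetric] fps_compose_sub_distrib
          fps_numeral_fps_const)
    finally show ?thesis
      using Y0 by (simp add: G_def fps_compose_mult_distrib mult.assoc)
  qed
  then have "of_nat N * (\<Sum>t\<in>small_zeroes N r. ?S t) = (\<Sum>c\<in>?U. fps_to_fls (of_nat m * (G oo Y c)))"
    unfolding zeroes sum.reindex[OF inj] sum_distrib_left by (intro sum.cong) simp_all
  also have "\<dots> = fps_to_fls (of_nat m * (\<Sum>c\<in>?U. G oo Y c))"
    by (simp only: fps_to_fls_sum sum_distrib_left)
  also have "\<dots> = fps_to_fls (of_nat m * (of_nat r * (h oo fps_X ^ (r * m))))"
    unfolding Y_def h_def by (simp only: sum_compose_roots_unity[OF r m])
  \<comment> \<open>The \<open>m\<close> from differentiating \<open>Y c\<close> and the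
    \<open>r\<close> from the roots of unity combine to the \<open>N\<close> on the left, which then
    cancels.\<close>
  also have "\<dots> = of_nat N * fps_to_fls (h oo fps_X ^ N)"
    by (simp add: N fls_times_fps_to_fls mult_ac)
  finally have "(\<Sum>t\<in>small_zeroes N r. ?S t) = fps_to_fls (h oo fps_X ^ N)"
    using assms by simp
  moreover have "tr_gf_puiseux N r = - (1/2) * fps_to_fls (h oo fps_X ^ N)"
  proof -
    have "tr_gf_puiseux N r = fps_to_fls (fps_const (- (1/2)) * (h oo fps_X ^ N))"
      using assms
      by (simp add: tr_gf_puiseux_def tr_gf_eq[OF r v] h_def G_def T_def fps_const_mult_apply_left)
    moreover have "fls_const (- (1/2)) = (- (1/2) :: complex fls)"
      by (simp add: flip: fls_const_divide_const)
    ultimately show ?thesis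
      by (simp add: fls_times_fps_to_fls)
  qed
  moreover have "card (small_zeroes N r) = r"
    by (simp add: zeroes card_image[OF inj] card_roots_unity_eq[OF r])
  ultimately show ?thesis
    by simp
qed

end
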